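(* The multirate Runge--Kutta--Chebyshev (mRKC) scheme is first-order accurate. That is, if $y$ is the solution of $y'=f(y)=f_F(y)+f_S(y)$, $y(0)=y_0$, with $f_F,f_S:\mathbb{R}^n\to\mathbb{R}^n$, and $y_1$ is the result of one step of size $\tau>0$ of the mRKC scheme starting from $y_0$, then $$\|y(\tau)-y_1\|=\mathcal{O}(\tau^2)\qquad\text{as }\tau\to0 .$$
   Context: $f_F$ and $f_S$ are assumed sufficiently smooth; $\|\cdot\|$ is the Euclidean norm. "First-order accurate" refers to the classical order: local error after one step of size $\mathcal{O}(\tau^2)$. mRKC scheme. Fix the damping $\varepsilon=0.05$ and $\beta=2-4\varepsilon/3$. Let $\rho_F,\rho_S$ be the spectral radii of the Jacobians of $f_F,f_S$ (evaluated at the current state $y_n$). Given a step size $\tau>0$, let $s\ge1$ be the smallest integer with $\tau\rho_S\le\beta s^2$, and let $m\ge2$ be the smallest integer with $\eta\rho_F\le\beta m^2$, where $$\eta=\frac{6\tau}{\beta s^2}\,\frac{m^2}{m^2-1}$$ (equivalently, $6\tau\rho_F\le\beta^2s^2(m^2-1)$). Let $T_j$ be the Chebyshev polynomial of the first kind of degree $j$. Outer coefficients: $\omega_0=1+\varepsilon/s^2$, $\omega_1=T_s(\omega_0)/T_s'(\omega_0)$, $b_j=1/T_j(\omega_0)$ for $j=0,\dots,s$, $\mu_1=\omega_1/\omega_0$, and $\mu_j=2\omega_1b_j/b_{j-1}$, $\nu_j=2\omega_0b_j/b_{j-1}$, $\kappa_j=-b_j/b_{j-2}$ for $j=2,\dots,s$.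 Inner coefficients: $\upsilon_0=1+\varepsilon/m^2$, $\upsilon_1=T_m(\upsilon_0)/T_m'(\upsilon_0)$, $a_j=1/T_j(\upsilon_0)$ for $j=0,\dots,m$, $\alpha_1=\upsilon_1/\upsilon_0$, and $\alpha_j=2\upsilon_1a_j/a_{j-1}$, $\beta_j=2\upsilon_0a_j/a_{j-1}$, $\gamma_j=-a_j/a_{j-2}$ for $j=2,\dots,m$. Numerical averaged force: for $y\in\mathbb{R}^n$, $\overline f_\eta(y)=\frac1\eta(u_\eta-y)$, where $u_\eta=u_m$ and $$u_0=y,\quad u_1=u_0+\alpha_1\eta(f_F(u_0)+f_S(y)),\quad u_j=\beta_ju_{j-1}+\gamma_ju_{j-2}+\alpha_j\eta(f_F(u_{j-1})+f_S(y)),\ j=2,\dots,m.$$ One step $y_n\mapsto y_{n+1}$ of mRKC: $$k_0=y_n,\quad k_1=k_0+\mu_1\tau\overline f_\eta(k_0),\quad k_j=\nu_jk_{j-1}+\kappa_jk_{j-2}+\mu_j\tau\overline f_\eta(k_{j-1}),\ j=2,\dots,s,\quad y_{n+1}=k_s.$$ *)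

theory Defs
  imports
    "HOL-Analysis.Analysis"
    "HOL-Computational_Algebra.Polynomial"
    "HOL-Library.Landau_Symbols"
begin

fun cheb_poly :: "nat \<Rightarrow> real poly" where
  "cheb_poly 0 = 1"
| "cheb_poly (Suc 0) = [:0, 1:]"
| "cheb_poly (Suc (Suc n)) = [:0, 2:] * cheb_poly (Suc n) - cheb_poly n"

(* The eigenvalues of a real matrix are its complex ones. *)
definition complex_spectrum :: "real^'n^'n \<Rightarrow> complex set" where
  "complex_spectrum A =
     {l. \<exists>v :: complex^'n. v \<noteq> 0 \<and> map_matrix complex_of_real A *v v = l *s v}"

definition spectral_radius :: "real^'n^'n \<Rightarrow> real" where
  "spectral_radius A = Max (cmod ` complex_spectrum A)"

(* Continuity of the Jacobian is with respect to the entrywise (= Euclidean) topology on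
   matrices, so this is continuous differentiability on the whole space. *)
definition C1_vector_field :: "(real^'n \<Rightarrow> real^'n) \<Rightarrow> bool" where
  "C1_vector_field f \<longleftrightarrow>
     (\<forall>x. f differentiable (at x)) \<and> continuous_on UNIV (\<lambda>x. jacobian f (at x))"

definition damping :: real where "damping = 0.05"

definition stab :: real where "stab = 2 - 4 * damping / 3"

(* Outer and inner coefficients of the scheme are given by the same formulas, with the number of
   stages s in one case and m in the other.  The functions below take this number as first
   argument p:
     p = s:  rkc_w0, rkc_w1, rkc_b, rkc_mu, rkc_nu, rkc_kappa
             are omega_0, omega_1, b_j, mu_j, nu_j, kappa_j;
     p = m:  they are upsilon_0, upsilon_1, a_j, alpha_j, beta_j, gamma_j. *)

definition rkc_w0 :: "nat \<Rightarrow> real" where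
  "rkc_w0 p = 1 + damping / (real p)^2"

definition rkc_w1 :: "nat \<Rightarrow> real" where
  "rkc_w1 p = poly (cheb_poly p) (rkc_w0 p) / poly (pderiv (cheb_poly p)) (rkc_w0 p)"

definition rkc_b :: "nat \<Rightarrow> nat \<Rightarrow> real" where
  "rkc_b p j = 1 / poly (cheb_poly j) (rkc_w0 p)"

(* rkc_mu is used only for j \<ge> 1, rkc_nu and rkc_kappa only for j \<ge> 2. *)
definition rkc_mu :: "nat \<Rightarrow> nat \<Rightarrow> real" where
  "rkc_mu p j =
     (if j = 1 then rkc_w1 p / rkc_w0 p else 2 * rkc_w1 p * rkc_b p j / rkc_b p (j - 1))"

definition rkc_nu :: "nat \<Rightarrow> nat \<Rightarrow> real" where
  "rkc_nu p j = 2 * rkc_w0 p * rkc_b p j / rkc_b p (j - 1)"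

definition rkc_kappa :: "nat \<Rightarrow> nat \<Rightarrow> real" where
  "rkc_kappa p j = - rkc_b p j / rkc_b p (j - 2)"

(* rkc_stage p h g y j is the j-th stage of the p-stage recursion with step size h and
   right-hand side g, started at y.  Both recursions of the scheme are instances. *)
fun rkc_stage :: "nat \<Rightarrow> real \<Rightarrow> (('a::real_vector) \<Rightarrow> 'a) \<Rightarrow> 'a \<Rightarrow> nat \<Rightarrow> 'a" where
  "rkc_stage p h g y 0 = y"
| "rkc_stage p h g y (Suc 0) = y + (rkc_mu p 1 * h) *\<^sub>R g y"
| "rkc_stage p h g y (Suc (Suc j)) =
     rkc_nu p (j + 2) *\<^sub>R rkc_stage p h g y (Suc j)
     + rkc_kappa p (j + 2) *\<^sub>R rkc_stage p h g y j
     + (rkc_mu p (j + 2) * h) *\<^sub>R g (rkc_stage p h g y (Suc j))"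

definition mrkc_s :: "real \<Rightarrow> real \<Rightarrow> nat" where
  "mrkc_s tau rhoS = (LEAST s. 1 \<le> s \<and> tau * rhoS \<le> stab * (real s)^2)"

definition mrkc_eta :: "real \<Rightarrow> nat \<Rightarrow> nat \<Rightarrow> real" where
  "mrkc_eta tau s m =
     (6 * tau / (stab * (real s)^2)) * ((real m)^2 / ((real m)^2 - 1))"

(* eta itself depends on the m being chosen. *)
definition mrkc_m :: "real \<Rightarrow> nat \<Rightarrow> real \<Rightarrow> nat" where
  "mrkc_m tau s rhoF = (LEAST m. 2 \<le> m \<and> mrkc_eta tau s m * rhoF \<le> stab * (real m)^2)"

(* The slow force is frozen at y, the state at which the averaged force is evaluated. *)
definition averaged_force ::
    "(('a::real_vector) \<Rightarrow> 'a) \<Rightarrow> ('a \<Rightarrow> 'a) \<Rightarrow> nat \<Rightarrow> real \<Rightarrow> 'a \<Rightarrow> 'a" where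
  "averaged_force fF fS m eta y =
     (1 / eta) *\<^sub>R (rkc_stage m eta (\<lambda>u. fF u + fS y) y m - y)"

definition mrkc_step ::
    "(real^'n \<Rightarrow> real^'n) \<Rightarrow> (real^'n \<Rightarrow> real^'n) \<Rightarrow> real \<Rightarrow> real^'n \<Rightarrow> real^'n" where
  "mrkc_step fF fS tau y =
     (let rhoF = spectral_radius (jacobian fF (at y));
          rhoS = spectral_radius (jacobian fS (at y));
          s = mrkc_s tau rhoS;
          m = mrkc_m tau s rhoF;
          eta = mrkc_eta tau s m
      in rkc_stage s tau (averaged_force fF fS m eta) y s)"

end

theory Submission
  imports Defs
begin

text \<open>
  The spectral radii do not depend on the step size, so the step-size conditions hold with
  the smallest admissible stage numbers \<open>s = 1\<close> and \<open>m = 2\<close> as soon as \<open>\<tau>\<close> is small. For these,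
  the step is \<open>y\<^sub>0 + \<tau> F + (\<tau>/2) (f\<^sub>F (y\<^sub>0 + c \<tau> F) - f\<^sub>F y\<^sub>0)\<close> with \<open>F = f\<^sub>F y\<^sub>0 + f\<^sub>S y\<^sub>0\<close> and a
  constant \<open>c\<close>, which differs from an explicit Euler step by \<open>O(\<tau>\<^sup>2)\<close>.
\<close>

text \<open>The increment is the derivative plus a remainder: boundedness of \<open>g'\<close>
  contributes the constant \<open>K\<close>, the remainder the constant 1. The version within
  \<open>S\<close> covers one-sided differentiability in time.\<close>

lemma differentiable_imp_norm_bigo:
  fixes g :: "'a::real_normed_vector \<Rightarrow> 'b::real_normed_vector"
  assumes "g differentiable (at x within S)"
  shows "(\<lambda>y. norm (g y - g x)) \<in> O[at x within S](\<lambda>y. norm (y - x))"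
proof -
  obtain g' where g': "(g has_derivative g') (at x within S)"
    using assms by (auto simp: differentiable_def)
  interpret bounded_linear g'
    using g' by (rule has_derivative_bounded_linear)
  obtain K where K: "\<And>z. norm (g' z) \<le> norm z * K"
    using bounded by blast
  obtain d where "d > 0" and d:
    "\<And>y. y \<in> S \<Longrightarrow> norm (y - x) < d \<Longrightarrow> norm (g y - g x - g' (y - x)) \<le> 1 * norm (y - x)"
    using g' unfolding has_derivative_within_alt by (meson zero_less_one)
  have "norm (g y - g x) \<le> (1 + K) * norm (y - x)" if "y \<in> S" "norm (y - x) < d" for y
  proof -
    have "norm (g y - g x) \<le> norm (g y - g x - g' (y - x)) + norm (g' (y - x))"
      by (metis diff_add_cancel norm_triangle_ineq)
    also have "\<dots> \<le> 1 * norm (y - x) + norm (y - x) * K"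
      using d[OF that] K by (rule add_mono)
    finally show ?thesis
      by (simp add: algebra_simps)
  qed
  then have "\<forall>\<^sub>F y in at x within S. norm (norm (g y - g x)) \<le> (1 + K) * norm (norm (y - x))"
    unfolding eventually_at using \<open>d > 0\<close> by (auto simp: dist_norm)
  then show ?thesis
    by (rule bigoI)
qed

text \<open>Chain rule along the ray. It serves to bound the change of the fast force at the inner
  stage, whose displacement is \<open>tau\<close> times a fixed vector.\<close>

lemma differentiable_ray_bigo:
  fixes g :: "'a::real_normed_vector \<Rightarrow> 'b::real_normed_vector"
  assumes "g differentiable (at x)"
  shows "(\<lambda>t. norm (g (x + t *\<^sub>R v) - g x)) \<in> O[at_right 0](\<lambda>t. t)"
proof -
  have "(\<lambda>t::real. x + t *\<^sub>R v) differentiable (at 0 within {0<..})"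
    by simp
  moreover have "g differentiable (at (x + 0 *\<^sub>R v) within (\<lambda>t. x + t *\<^sub>R v) ` {0<..})"
    using assms by (simp add: differentiable_at_withinI)
  ultimately have "(g \<circ> (\<lambda>t. x + t *\<^sub>R v)) differentiable (at 0 within {0<..})"
    by (rule differentiable_chain_within)
  from differentiable_imp_norm_bigo[OF this] show ?thesis
    by simp
qed

text \<open>Differentiability of \<open>f\<close> at the initial value suffices:
  \<open>f \<circ> y\<close> is then differentiable at 0, so the velocity of \<open>y\<close> varies
  by O(t), and the mean value inequality integrates this to O(t^2).\<close>

lemma autonomous_ode_euler_bigo:
  fixes f :: "'a::real_normed_vector \<Rightarrow> 'a" and y :: "real \<Rightarrow> 'a"
  assumes f: "f differentiable (at (y 0))" and "t1 > 0"
    and y: "\<And>t. t \<in> {0..t1} \<Longrightarrow> (y has_vector_derivative f (y t)) (at t within {0..t1})"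
  shows "(\<lambda>t. norm (y t - y 0 - t *\<^sub>R f (y 0))) \<in> O[at_right 0](\<lambda>t. t\<^sup>2)"
proof -
  have "y differentiable (at 0 within {0..t1})"
    using y[of 0] \<open>t1 > 0\<close> by (auto simp: has_vector_derivative_def differentiable_def)
  then have "(f \<circ> y) differentiable (at 0 within {0..t1})"
    using differentiable_at_withinI[OF f] by (rule differentiable_chain_within)
  from differentiable_imp_norm_bigo[OF this]
  obtain C where "C > 0" and "\<forall>\<^sub>F t in at 0 within {0..t1}. norm (f (y t) - f (y 0)) \<le> C * \<bar>t\<bar>"
    by (rule landau_o.bigE) simp
  then obtain d where "d > 0" and d_within:
    "\<And>t. t \<in> {0..t1} \<Longrightarrow> t \<noteq> 0 \<Longrightarrow> dist t 0 < d \<Longrightarrow> norm (f (y t) - f (y 0)) \<le> C * \<bar>t\<bar>"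
    unfolding eventually_at by blast
  have d: "norm (f (y t) - f (y 0)) \<le> C * t" if "0 < t" "t \<le> t1" "t < d" for t
    using d_within[of t] that by simp
  have "norm (y t - y 0 - t *\<^sub>R f (y 0)) \<le> C * t\<^sup>2" if t: "0 < t" "t < min d t1" for t
  proof -
    define z where "z = (\<lambda>r. y r - r *\<^sub>R f (y 0))"
    \<comment> \<open>Mean value inequality with the majorant \<open>C * t * r\<close> as a function
      of \<open>r\<close>: the derivative of \<open>z\<close> at \<open>r\<close> is bounded by
      \<open>C * r\<close>, hence by the constant \<open>C * t\<close>.\<close>
    have "norm (z t - z 0) \<le> C * t * t - C * t * 0"
    proof (rule differentiable_bound_general[OF \<open>0 < t\<close>, where f' = "\<lambda>r. f (y r) - f (y 0)"
          and \<phi>' = "\<lambda>_. C * t"])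
      have "continuous_on {0..t1} y"
        using y by (rule continuous_on_vector_derivative)
      then have "continuous_on {0..t} y"
        by (rule continuous_on_subset) (use t in auto)
      then show "continuous_on {0..t} z"
        unfolding z_def by (intro continuous_intros)
    next
      fix r assume r: "0 < r" "r < t"
      have "(y has_vector_derivative f (y r)) (at r within {0..t1})"
        using r t by (intro y) auto
      moreover have "at r within {0..t1} = at r"
        using r t by (intro at_within_interior) simp
      ultimately show "(z has_vector_derivative f (y r) - f (y 0)) (at r)"
        unfolding z_def by (auto intro!: derivative_eq_intros)
      have "norm (f (y r) - f (y 0)) \<le> C * r"
        using r t by (intro d) auto
      also have "\<dots> \<le> C * t"
        using r \<open>C > 0\<close> by simp
      finally show "norm (f (y r) - f (y 0)) \<le> C * t" .
      show "((\<lambda>r. C * t * r) has_vector_derivative C * t) (at r)"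
        by (auto intro!: derivative_eq_intros simp flip: has_real_derivative_iff_has_vector_derivative)
    qed (intro continuous_intros)
    then show ?thesis
      by (simp add: z_def power2_eq_square algebra_simps)
  qed
  then have "\<forall>\<^sub>F t in at_right 0. norm (norm (y t - y 0 - t *\<^sub>R f (y 0))) \<le> C * norm (t\<^sup>2)"
    using \<open>d > 0\<close> \<open>t1 > 0\<close>
    by (intro eventually_at_rightI[of 0 "min d t1"]) auto
  then show ?thesis
    by (rule bigoI)
qed

lemma cheb_poly_2: "cheb_poly 2 = [:-1, 0, 2:]"
  by (simp add: numeral_2_eq_2 one_pCons)

lemma rkc_w0_ge_1: "rkc_w0 p \<ge> 1"
  by (simp add: rkc_w0_def damping_def)

text \<open>Since T_1(x) = x, the damping cancels from \<open>rkc_mu 1 1\<close>, leaving an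
  explicit Euler step.\<close>

lemma rkc_stage_one: "rkc_stage 1 h g y 1 = y + h *\<^sub>R g y"
proof -
  have "rkc_mu 1 1 = 1"
    using rkc_w0_ge_1[of 1] by (simp add: rkc_mu_def rkc_w1_def pderiv_pCons)
  then show ?thesis
    by simp
qed

text \<open>An Euler step plus a correction that measures only the variation of \<open>g\<close>.
  The damping survives solely in \<open>rkc_mu 2 1\<close>, that is, in the point where
  \<open>g\<close> is evaluated again.\<close>

lemma rkc_stage_two:
  "rkc_stage 2 h g y 2 =
     y + h *\<^sub>R g y + (h / 2) *\<^sub>R (g (y + (rkc_mu 2 1 * h) *\<^sub>R g y) - g y)"
proof -
  define w where "w = rkc_w0 2"
  \<comment> \<open>This is T_2(w), the denominator of the second stage coefficients.\<close>
  define q where "q = 2 * w\<^sup>2 - 1"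
  have "w \<ge> 1"
    using rkc_w0_ge_1 by (simp add: w_def)
  then have "w\<^sup>2 \<ge> 1"
    by simp
  then have "q > 0"
    by (simp add: q_def)
  have b: "rkc_b 2 0 = 1" "rkc_b 2 (Suc 0) = 1 / w" "rkc_b 2 2 = 1 / q"
    by (simp_all add: rkc_b_def cheb_poly_2 w_def q_def power2_eq_square algebra_simps)
  have w1: "rkc_w1 2 = q / (4 * w)"
    by (simp add: rkc_w1_def cheb_poly_2 pderiv_pCons w_def q_def power2_eq_square algebra_simps)
  have mu1: "rkc_mu 2 1 = q / (4 * w\<^sup>2)"
    using \<open>w \<ge> 1\<close> by (simp add: rkc_mu_def w1 power2_eq_square flip: w_def)
  have mu2: "rkc_mu 2 2 = 1 / 2"
    using \<open>w \<ge> 1\<close> \<open>q > 0\<close> by (simp add: rkc_mu_def w1 b)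
  have nu: "rkc_nu 2 2 = 2 * w\<^sup>2 / q"
    using \<open>w \<ge> 1\<close> by (simp add: rkc_nu_def b power2_eq_square flip: w_def)
  \<comment> \<open>Consistency, from the Chebyshev recurrence at \<open>w\<close>: the total weight
    of \<open>y\<close> in the second stage is 1.\<close>
  have kappa: "rkc_kappa 2 2 = 1 - rkc_nu 2 2"
    using \<open>q > 0\<close> by (simp add: rkc_kappa_def nu b field_simps) (simp add: q_def)
  \<comment> \<open>Together with \<open>mu2\<close>, this makes both evaluations of
    \<open>g\<close> enter with weight \<open>h / 2\<close>.\<close>
  have numu: "rkc_nu 2 2 * rkc_mu 2 1 = 1 / 2"
    unfolding nu mu1 using \<open>w \<ge> 1\<close> \<open>q > 0\<close> by simp
  have split: "h *\<^sub>R g y = (h / 2) *\<^sub>R g y + (h / 2) *\<^sub>R g y"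
    by (simp flip: scaleR_add_left)
  define G where "G = g (y + (rkc_mu 2 1 * h) *\<^sub>R g y)"
  have "rkc_stage 2 h g y 2 = rkc_nu 2 2 *\<^sub>R (y + (rkc_mu 2 1 * h) *\<^sub>R g y)
      + rkc_kappa 2 2 *\<^sub>R y + (rkc_mu 2 2 * h) *\<^sub>R G"
    using rkc_stage.simps(3)[of 2 h g y 0] by (simp add: G_def numeral_2_eq_2)
  also have "\<dots> = y + ((rkc_nu 2 2 * rkc_mu 2 1) * h) *\<^sub>R g y + (h / 2) *\<^sub>R G"
    by (simp add: kappa mu2 algebra_simps)
  also have "\<dots> = y + (h / 2) *\<^sub>R g y + (h / 2) *\<^sub>R G"
    unfolding numu by simp
  also have "\<dots> = y + h *\<^sub>R g y + (h / 2) *\<^sub>R (G - g y)"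
    by (subst split) (simp add: scaleR_diff_right)
  finally show ?thesis
    by (simp add: G_def)
qed

lemma averaged_force_two:
  assumes "eta \<noteq> 0"
  shows "averaged_force fF fS 2 eta y = fF y + fS y
    + (1 / 2) *\<^sub>R (fF (y + (rkc_mu 2 1 * eta) *\<^sub>R (fF y + fS y)) - fF y)"
  using assms by (simp add: averaged_force_def rkc_stage_two algebra_simps)

lemma eventually_linear_le:
  fixes a b :: real
  assumes "b > 0"
  shows "\<forall>\<^sub>F t in at_right 0. t * a \<le> b"
proof -
  have "((\<lambda>t. t * a) \<longlongrightarrow> 0 * a) (at_right 0)"
    by (intro tendsto_intros)
  then have "\<forall>\<^sub>F t in at_right 0. t * a < b"
    using assms by (auto dest: order_tendstoD(2))
  then show ?thesis
    by eventually_elim simp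
qed

lemma stab_pos: "stab > 0"
  by (simp add: stab_def damping_def)

text \<open>For fixed \<open>rhoS\<close>, the product \<open>tau * rhoS\<close> tends to 0, while
  the bound for one stage is the positive constant \<open>stab\<close>.\<close>

lemma mrkc_s_eventually: "\<forall>\<^sub>F tau in at_right 0. mrkc_s tau rhoS = 1"
  using eventually_linear_le[OF stab_pos, of rhoS]
  by eventually_elim (auto simp: mrkc_s_def intro!: Least_equality)

text \<open>For m = 2 the factor m^2 / (m^2 - 1) is 4/3, and 6 * 4/3 = 8. Thus \<open>eta\<close> is
  proportional to \<open>tau\<close>.\<close>

lemma mrkc_eta_1_2: "mrkc_eta tau 1 2 = (8 / stab) * tau"
  by (simp add: mrkc_eta_def)

lemma mrkc_m_eventually: "\<forall>\<^sub>F tau in at_right 0. mrkc_m tau 1 rhoF = 2"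
proof -
  have "\<forall>\<^sub>F tau in at_right 0. tau * (8 / stab * rhoF) \<le> stab * 4"
    using stab_pos by (intro eventually_linear_le) simp
  then show ?thesis
  proof eventually_elim
    case (elim tau)
    then have "mrkc_eta tau 1 2 * rhoF \<le> stab * (real 2)\<^sup>2"
      unfolding mrkc_eta_1_2 by (simp add: mult_ac)
    then show ?case
      unfolding mrkc_m_def by (intro Least_equality) auto
  qed
qed

lemma mrkc_step_eventually:
  fixes fF fS :: "real^'n \<Rightarrow> real^'n" and y :: "real^'n"
  defines "F \<equiv> fF y + fS y"
  shows "\<forall>\<^sub>F tau in at_right 0. mrkc_step fF fS tau y = y + tau *\<^sub>R F
    + (tau / 2) *\<^sub>R (fF (y + tau *\<^sub>R ((rkc_mu 2 1 * (8 / stab)) *\<^sub>R F)) - fF y)"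
  using mrkc_s_eventually[of "spectral_radius (jacobian fS (at y))"]
    mrkc_m_eventually[of "spectral_radius (jacobian fF (at y))"]
    \<comment> \<open>Positivity of \<open>tau\<close> ensures that the division by
      \<open>eta\<close> in the averaged force is legitimate.\<close>
    eventually_at_right_less[of 0]
proof eventually_elim
  case (elim tau)
  then have "mrkc_eta tau 1 2 \<noteq> 0"
    unfolding mrkc_eta_1_2 using stab_pos by simp
  then have "averaged_force fF fS 2 (mrkc_eta tau 1 2) y
      = F + (1 / 2) *\<^sub>R (fF (y + (rkc_mu 2 1 * mrkc_eta tau 1 2) *\<^sub>R F) - fF y)"
    unfolding F_def by (rule averaged_force_two)
  moreover have "(rkc_mu 2 1 * mrkc_eta tau 1 2) *\<^sub>R F = tau *\<^sub>R ((rkc_mu 2 1 * (8 / stab)) *\<^sub>R F)"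
    unfolding mrkc_eta_1_2 by simp
  moreover have "mrkc_step fF fS tau y
      = y + tau *\<^sub>R averaged_force fF fS 2 (mrkc_eta tau 1 2) y"
    using elim by (simp only: mrkc_step_def Let_def rkc_stage_one)
  ultimately show ?case
    by (simp only: scaleR_add_right) simp
qed

theorem theorem4p6:
  fixes fF fS :: "real^'n \<Rightarrow> real^'n"
    and y :: "real \<Rightarrow> real^'n" and y0 :: "real^'n" and t1 :: real
  assumes "C1_vector_field fF" and "C1_vector_field fS"
    and "t1 > 0"
    and "y 0 = y0"
    and "\<And>t. t \<in> {0..t1} \<Longrightarrow>
           (y has_vector_derivative (fF (y t) + fS (y t))) (at t within {0..t1})"
  shows "(\<lambda>tau. norm (y tau - mrkc_step fF fS tau y0)) \<in> O[at_right 0](\<lambda>tau. tau^2)"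
proof -
  define F where "F = fF y0 + fS y0"
  \<comment> \<open>The inner stage lies at \<open>y0 + tau *\<^sub>R v\<close>; \<open>v\<close> is
    independent of \<open>tau\<close>.\<close>
  define v where "v = (rkc_mu 2 1 * (8 / stab)) *\<^sub>R F"
  define e where "e = (\<lambda>tau. norm (y tau - y0 - tau *\<^sub>R F))"
  define r where "r = (\<lambda>tau. norm (fF (y0 + tau *\<^sub>R v) - fF y0))"
  have fF: "fF differentiable (at y0)" and fS: "fS differentiable (at y0)"
    using assms(1,2) by (auto simp: C1_vector_field_def)
  have "(\<lambda>x. fF x + fS x) differentiable (at (y 0))"
    using fF fS \<open>y 0 = y0\<close> by simp
  from autonomous_ode_euler_bigo[OF this \<open>t1 > 0\<close> assms(5)]
  have e: "e \<in> O[at_right 0](\<lambda>tau. tau\<^sup>2)"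
    using \<open>y 0 = y0\<close> by (simp add: e_def F_def)
  have "r \<in> O[at_right 0](\<lambda>tau. tau)"
    unfolding r_def using fF by (rule differentiable_ray_bigo)
  \<comment> \<open>The outer step size supplies the second power of \<open>tau\<close>.\<close>
  then have "(\<lambda>tau. tau * r tau) \<in> O[at_right 0](\<lambda>tau. tau\<^sup>2)"
    unfolding power2_eq_square by (rule landau_o.big.mult_left)
  then have "(\<lambda>tau. e tau + tau * r tau) \<in> O[at_right 0](\<lambda>tau. tau\<^sup>2)"
    by (rule sum_in_bigo(1)[OF e])
  \<comment> \<open>The Euler terms of solution and scheme cancel, leaving the Euler error
    \<open>e\<close> and half of \<open>tau * r tau\<close>; the factor 1/2 is then dropped.\<close>
  moreover have "\<forall>\<^sub>F tau in at_right 0.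
      norm (norm (y tau - mrkc_step fF fS tau y0)) \<le> norm (e tau + tau * r tau)"
    using mrkc_step_eventually[of fF fS y0] eventually_at_right_less[of 0]
  proof eventually_elim
    case (elim tau)
    then have diff: "y tau - mrkc_step fF fS tau y0
        = (y tau - y0 - tau *\<^sub>R F) - (tau / 2) *\<^sub>R (fF (y0 + tau *\<^sub>R v) - fF y0)"
      by (simp add: F_def v_def)
    have "norm (y tau - mrkc_step fF fS tau y0) \<le> e tau + tau / 2 * r tau"
      unfolding diff using norm_triangle_ineq4[of "y tau - y0 - tau *\<^sub>R F"
          "(tau / 2) *\<^sub>R (fF (y0 + tau *\<^sub>R v) - fF y0)"] \<open>0 < tau\<close>
      by (simp add: e_def r_def)
    also have "\<dots> \<le> e tau + tau * r tau"
      using \<open>0 < tau\<close> by (simp add: r_def)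
    finally show ?case
      by simp
  qed
  ultimately show ?thesis
    by (rule landau_o.big_trans[OF landau_o.big_mono, rotated])
qed

end
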